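(* Let $V=\{v_0,v_1,\dots\}$ with weight grading $\mathrm{wt}(v_0)=1$, $\mathrm{wt}(v_i)=i$ ($i\ge1$), let $V_0\subset V$, and let $\Delta_I$ be the coproduct on $\mathbb Q\langle V\rangle$ dual to the Grossman–Larson product $\circledast_I$. Then for all $a_1,\dots,a_n\in V$, \begin{align*} \Delta_I(a_1\cdots a_n)=\sum_{\substack{0\le k\le n\\0\le i_1<j_1\le i_2<j_2\le\cdots\le i_k<j_k\le n}}\Big(&a_1\cdots a_{i_1}⧢\mathbb I\big(S(a_{i_1+1}\cdots a_{j_1-1})⧢a_{j_1+1}\cdots a_{i_2};a_{j_1}\big)⧢\cdots\\ &⧢\mathbb I\big(S(a_{i_k+1}\cdots a_{j_k-1})⧢a_{j_k+1}\cdots a_n;a_{j_k}\big)\Big)\otimes a_{j_1}\cdots a_{j_k}. \end{align*}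
   Context: $\mathbb Q\langle V\rangle$: free associative algebra on $V$, identified with $U(\mathrm{Lie}(V))$, with shuffle coproduct $\Delta$ (letters primitive, Sweedler notation $A_{(1)}\otimes A_{(2)}$), antipode $S(a_1\cdots a_n)=(-1)^na_n\cdots a_1$ and shuffle product $⧢$ ($\mathbf1⧢A=A⧢\mathbf1=A$, $xA⧢yB=x(A⧢yB)+y(xA⧢B)$). For $t\in\mathrm{Lie}(V)$, $t\triangleright_I$ is the derivation of $\mathrm{Lie}(V)$ with $t\triangleright_I v=0$ for $v\in V_0$, $t\triangleright_I v=[v,t]$ for $v\notin V_0$; $(\mathrm{Lie}(V),[\cdot,\cdot],\triangleright_I)$ is a post-Lie algebra. $\triangleright_I$ is extended to $\mathbb Q\langle V\rangle^{\otimes2}$ by $x\triangleright\mathbf1=0$, $\mathbf1\triangleright A=A$, $xA\triangleright y=x\triangleright(A\triangleright y)-(x\triangleright A)\triangleright y$, $A\triangleright BC=(A_{(1)}\triangleright B)(A_{(2)}\triangleright C)$ ($x,y\in\mathrm{Lie}(V)$), and $A\circledast_IB=A_{(1)}(A_{(2)}\triangleright_IB)$. With the pairing making words orthonormal, $\Delta_I$ is defined by $(A\circledast_IB\mid C)=(A\otimes B\mid\Delta_I(C))$. For a word $w$ and a letter $v$, $\mathbb I(w;v)=w$ if $v\notin V_0$ and $\mathbb I(w;v)=\delta_{w,\mathbf1}w$ if $v\in V_0$, extended linearly in $w$. Empty products of letters are $\mathbf1$. *)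

theory Defs
  imports Complex_Main "HOL-Library.Poly_Mapping" "HOL-Library.Product_Plus"
begin

text \<open>The number \<open>i\<close> stands for the letter \<open>v\<^sub>i\<close> of \<open>V = {v\<^sub>0, v\<^sub>1, \<dots>}\<close>.  The weight grading
  (\<open>v\<^sub>0\<close> of weight \<open>1\<close>, \<open>v\<^sub>i\<close> of weight \<open>i\<close> for \<open>i \<ge> 1\<close>) has finite-dimensional homogeneous parts,
  which is what identifies the algebra with its graded dual; it does not enter the
  definitions below, where duality is expressed by the pairing on words.\<close>
type_synonym letter = nat

text \<open>Words form the free monoid.  In additive notation, the convolution product of
  \<^theory>\<open>HOL-Library.Poly_Mapping\<close> is then the concatenation product on
  \<open>letter list \<Rightarrow>\<^sub>0 rat\<close>, and, by the componentwise monoid structure on pairs, the product of the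
  tensor square on \<open>letter list \<times> letter list \<Rightarrow>\<^sub>0 rat\<close>.\<close>
instantiation list :: (type) monoid_add
begin
definition zero_list :: "'a list" where "zero_list = []"
definition plus_list :: "'a list \<Rightarrow> 'a list \<Rightarrow> 'a list" where "plus_list = (@)"
instance by standard (simp_all add: zero_list_def plus_list_def)
end

type_synonym word = "letter list"
type_synonym ncpoly = "word \<Rightarrow>\<^sub>0 rat"
type_synonym ncpoly2 = "word \<times> word \<Rightarrow>\<^sub>0 rat"

abbreviation mono_word :: "word \<Rightarrow> ncpoly" where
  "mono_word w \<equiv> Poly_Mapping.single w 1"

definition smul :: "rat \<Rightarrow> ('a \<Rightarrow>\<^sub>0 rat) \<Rightarrow> ('a \<Rightarrow>\<^sub>0 rat)" where
  "smul c A = Poly_Mapping.map ((*) c) A"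

text \<open>The linear map with prescribed values on the basis.\<close>
definition linext :: "('a \<Rightarrow> ('b \<Rightarrow>\<^sub>0 rat)) \<Rightarrow> ('a \<Rightarrow>\<^sub>0 rat) \<Rightarrow> ('b \<Rightarrow>\<^sub>0 rat)" where
  "linext f A = (\<Sum>w\<in>Poly_Mapping.keys A. smul (Poly_Mapping.lookup A w) (f w))"

definition tensor :: "ncpoly \<Rightarrow> ncpoly \<Rightarrow> ncpoly2" where
  "tensor A B = linext (\<lambda>u. linext (\<lambda>v. Poly_Mapping.single (u, v) 1) B) A"

text \<open>The pairing for which the basis is orthonormal.\<close>
definition pairing :: "('a \<Rightarrow>\<^sub>0 rat) \<Rightarrow> ('a \<Rightarrow>\<^sub>0 rat) \<Rightarrow> rat" where
  "pairing A B = (\<Sum>w\<in>Poly_Mapping.keys A. Poly_Mapping.lookup A w * Poly_Mapping.lookup B w)"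

fun coprod_word :: "word \<Rightarrow> ncpoly2" where
  "coprod_word [] = 1"
| "coprod_word (a # w) =
     (tensor (mono_word [a]) 1 + tensor 1 (mono_word [a])) * coprod_word w"

definition coprod :: "ncpoly \<Rightarrow> ncpoly2" where
  "coprod = linext coprod_word"

text \<open>\<open>sweedler f A\<close> is \<open>f A\<^sub>(\<^sub>1\<^sub>) A\<^sub>(\<^sub>2\<^sub>)\<close> for bilinear \<open>f\<close>, summation understood.\<close>
definition sweedler :: "(ncpoly \<Rightarrow> ncpoly \<Rightarrow> ncpoly) \<Rightarrow> ncpoly \<Rightarrow> ncpoly" where
  "sweedler f A = linext (\<lambda>(u, v). f (mono_word u) (mono_word v)) (coprod A)"

definition antipode :: "ncpoly \<Rightarrow> ncpoly" where
  "antipode = linext (\<lambda>w. Poly_Mapping.single (rev w) ((- 1) ^ length w))"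

fun shuffle_word :: "word \<Rightarrow> word \<Rightarrow> ncpoly" where
  "shuffle_word [] w = mono_word w"
| "shuffle_word (x # u) [] = mono_word (x # u)"
| "shuffle_word (x # u) (y # v) =
     mono_word [x] * shuffle_word u (y # v) + mono_word [y] * shuffle_word (x # u) v"

definition shuffle :: "ncpoly \<Rightarrow> ncpoly \<Rightarrow> ncpoly" where
  "shuffle A B = linext (\<lambda>u. linext (shuffle_word u) B) A"

definition bracket :: "ncpoly \<Rightarrow> ncpoly \<Rightarrow> ncpoly" where
  "bracket A B = A * B - B * A"

text \<open>The free Lie algebra, as the Lie subalgebra generated by the letters.\<close>
inductive_set Lie :: "ncpoly set" where
  letter: "mono_word [v] \<in> Lie"
| add: "x \<in> Lie \<Longrightarrow> y \<in> Lie \<Longrightarrow> x + y \<in> Lie"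
| scale: "x \<in> Lie \<Longrightarrow> smul c x \<in> Lie"
| bracket: "x \<in> Lie \<Longrightarrow> y \<in> Lie \<Longrightarrow> bracket x y \<in> Lie"

definition lie_derivation :: "(ncpoly \<Rightarrow> ncpoly) \<Rightarrow> bool" where
  "lie_derivation D \<longleftrightarrow>
     (\<forall>x\<in>Lie. D x \<in> Lie) \<and>
     (\<forall>x\<in>Lie. \<forall>y\<in>Lie. D (x + y) = D x + D y) \<and>
     (\<forall>c. \<forall>x\<in>Lie. D (smul c x) = smul c (D x)) \<and>
     (\<forall>x\<in>Lie. \<forall>y\<in>Lie. D (bracket x y) = bracket (D x) y + bracket x (D y))"

definition is_post_lie_product_I :: "letter set \<Rightarrow> (ncpoly \<Rightarrow> ncpoly \<Rightarrow> ncpoly) \<Rightarrow> bool" where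
  "is_post_lie_product_I V0 T \<longleftrightarrow>
     (\<forall>t\<in>Lie. lie_derivation (T t) \<and>
        (\<forall>v. T t (mono_word [v]) = (if v \<in> V0 then 0 else bracket (mono_word [v]) t)))"

definition is_bilinear :: "(ncpoly \<Rightarrow> ncpoly \<Rightarrow> ncpoly) \<Rightarrow> bool" where
  "is_bilinear T \<longleftrightarrow>
     (\<forall>A. Vector_Spaces.linear smul smul (T A)) \<and>
     (\<forall>B. Vector_Spaces.linear smul smul (\<lambda>A. T A B))"

definition is_enveloping_extension :: "(ncpoly \<Rightarrow> ncpoly \<Rightarrow> ncpoly) \<Rightarrow> bool" where
  "is_enveloping_extension T \<longleftrightarrow>
     is_bilinear T \<and>
     (\<forall>x\<in>Lie. T x 1 = 0) \<and>
     (\<forall>A. T 1 A = A) \<and>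
     (\<forall>x\<in>Lie. \<forall>A. \<forall>y\<in>Lie. T (x * A) y = T x (T A y) - T (T x A) y) \<and>
     (\<forall>A B C. T A (B * C) = sweedler (\<lambda>A1 A2. T A1 B * T A2 C) A)"

text \<open>These conditions determine a unique operation: \<open>A\<close> acts on a letter \<open>v \<notin> V0\<close> by
  \<open>S(A\<^sub>(\<^sub>1\<^sub>)) v A\<^sub>(\<^sub>2\<^sub>)\<close> and on \<open>v \<in> V0\<close> by the counit.\<close>
definition tri_I :: "letter set \<Rightarrow> ncpoly \<Rightarrow> ncpoly \<Rightarrow> ncpoly" where
  "tri_I V0 = (THE T. is_post_lie_product_I V0 T \<and> is_enveloping_extension T)"

text \<open>The Grossman--Larson product.\<close>
definition gl_I :: "letter set \<Rightarrow> ncpoly \<Rightarrow> ncpoly \<Rightarrow> ncpoly" where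
  "gl_I V0 A B = sweedler (\<lambda>A1 A2. A1 * tri_I V0 A2 B) A"

definition Delta_I :: "letter set \<Rightarrow> ncpoly \<Rightarrow> ncpoly2" where
  "Delta_I V0 C = (THE X. \<forall>A B. pairing (gl_I V0 A B) C = pairing (tensor A B) X)"

definition II :: "letter set \<Rightarrow> ncpoly \<Rightarrow> letter \<Rightarrow> ncpoly" where
  "II V0 A v = linext (\<lambda>w. if v \<in> V0 then (if w = [] then mono_word w else 0) else mono_word w) A"

text \<open>\<open>a\<^sub>p \<cdots> a\<^sub>q\<close>, the empty word if \<open>p > q\<close>.\<close>
definition letters :: "(nat \<Rightarrow> letter) \<Rightarrow> nat \<Rightarrow> nat \<Rightarrow> ncpoly" where
  "letters a p q = mono_word (map a [p..<Suc q])"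

text \<open>The sequences \<open>0 \<le> i\<^sub>1 < j\<^sub>1 \<le> i\<^sub>2 < j\<^sub>2 \<le> \<dots> \<le> i\<^sub>k < j\<^sub>k \<le> n\<close>.  The list \<open>i\<close> has the additional
  last entry \<open>i\<^sub>k\<^sub>+\<^sub>1 = n\<close>; list positions count from \<open>0\<close>, so \<open>i ! l\<close> is \<open>i\<^sub>l\<^sub>+\<^sub>1\<close>
  and \<open>j ! l\<close> is \<open>j\<^sub>l\<^sub>+\<^sub>1\<close>.\<close>
definition interlaced :: "nat \<Rightarrow> nat \<Rightarrow> (nat list \<times> nat list) set" where
  "interlaced n k = {(i, j). length i = k + 1 \<and> length j = k \<and> i ! k = n \<and>
     (\<forall>l<k. i ! l < j ! l \<and> j ! l \<le> i ! (l + 1))}"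

end

theory Submission
  imports Defs
begin

text \<open>Linear maps on \<open>\<rat>\<langle>V\<rangle>\<close> form an algebra under the convolution
  \<open>(f \<star> g)(A) = f(A\<^sub>(\<^sub>1\<^sub>)) g(A\<^sub>(\<^sub>2\<^sub>))\<close>.  The action \<open>\<triangleright>\<^sub>I\<close> satisfies
  \<open>(\<cdot> \<triangleright> v\<^sub>1\<cdots>v\<^sub>k) = \<tau>\<^sub>1 \<star> \<cdots> \<star> \<tau>\<^sub>k\<close>, where \<open>\<tau>\<^sub>l = S \<star> v\<^sub>l \<star> id\<close> for \<open>v\<^sub>l \<notin> V\<^sub>0\<close> and
  \<open>\<tau>\<^sub>l = v\<^sub>l \<epsilon>\<close> for \<open>v\<^sub>l \<in> V\<^sub>0\<close>, so that
  \<open>(\<cdot> \<circledast>\<^sub>I v\<^sub>1\<cdots>v\<^sub>k) = id \<star> \<tau>\<^sub>1 \<star> \<cdots> \<star> \<tau>\<^sub>k\<close>.  The coefficient of a word \<open>c\<close> in a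
  convolution product is a sum over the deconcatenations of \<open>c\<close> of shuffle products of
  coefficient functionals; the endpoints \<open>i\<^sub>l\<close> of the pieces and the positions \<open>j\<^sub>l\<close> of the letters
  \<open>v\<^sub>l\<close> in the pieces are the summation indices of the formula.\<close>

section \<open>Linear maps on finitely supported functions\<close>

lemma lookup_smul [simp]: "Poly_Mapping.lookup (smul c A) k = c * Poly_Mapping.lookup A k"
  by (simp add: smul_def Poly_Mapping.map.rep_eq when_def)

interpretation smul: vector_space "smul :: rat \<Rightarrow> ('a \<Rightarrow>\<^sub>0 rat) \<Rightarrow> ('a \<Rightarrow>\<^sub>0 rat)"
  by standard (auto intro!: poly_mapping_eqI simp: lookup_add algebra_simps)

abbreviation lin :: "(('a \<Rightarrow>\<^sub>0 rat) \<Rightarrow> ('b \<Rightarrow>\<^sub>0 rat)) \<Rightarrow> bool" where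
  "lin \<equiv> Vector_Spaces.linear smul smul"

lemma lin_iff:
  "lin f \<longleftrightarrow> (\<forall>x y. f (x + y) = f x + f y) \<and> (\<forall>c x. f (smul c x) = smul c (f x))"
  by (simp add: Vector_Spaces.linear_iff smul.vector_space_axioms)

lemma linI:
  assumes "\<And>x y. f (x + y) = f x + f y" "\<And>c x. f (smul c x) = smul c (f x)"
  shows "lin f"
  using assms by (simp add: lin_iff)

lemma
  assumes "lin f"
  shows lin_add: "f (x + y) = f x + f y" and lin_smul: "f (smul c x) = smul c (f x)"
    and lin_zero: "f 0 = 0" and lin_minus: "f (- x) = - f x" and lin_diff: "f (x - y) = f x - f y"
proof -
  interpret Vector_Spaces.linear smul smul f by fact
  show "f (x + y) = f x + f y" "f (smul c x) = smul c (f x)" "f 0 = 0"  "f (- x) = - f x"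
    "f (x - y) = f x - f y"
    by (simp_all add: add scale diff neg)
qed

text \<open>Keys outside the support carry coefficient zero. Sums belonging to different arguments
  can thus be taken over one common finite set, as linearity requires.\<close>

lemma linext_superset:
  assumes "finite K" "Poly_Mapping.keys A \<subseteq> K"
  shows "linext f A = (\<Sum>w\<in>K. smul (Poly_Mapping.lookup A w) (f w))"
  unfolding linext_def by (rule sum.mono_neutral_left) (use assms in \<open>auto simp: in_keys_iff\<close>)

lemma lin_linext: "lin (linext f)"
proof (rule linI)
  fix x y :: "'a \<Rightarrow>\<^sub>0 rat" and c
  let ?K = "Poly_Mapping.keys x \<union> Poly_Mapping.keys y"
  have K: "finite ?K" "Poly_Mapping.keys (x + y) \<subseteq> ?K"
    by (auto simp: Poly_Mapping.keys_add)
  show "linext f (x + y) = linext f x + linext f y"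
    using linext_superset[OF K, of f] linext_superset[of ?K x f] linext_superset[of ?K y f]
    by (simp add: lookup_add smul.scale_left_distrib sum.distrib)
  have "Poly_Mapping.keys (smul c x) \<subseteq> Poly_Mapping.keys x"
    by (auto simp: in_keys_iff)
  then show "linext f (smul c x) = smul c (linext f x)"
    using linext_superset[of "Poly_Mapping.keys x" "smul c x" f]
    by (simp add: linext_def smul.scale_sum_right)
qed

lemmas linext_add = lin_add[OF lin_linext]
  and linext_smul = lin_smul[OF lin_linext]
  and linext_zero [simp] = lin_zero[OF lin_linext]
  and linext_diff = lin_diff[OF lin_linext]

lemma linext_mono [simp]: "linext f (Poly_Mapping.single w 1) = f w"
  by (simp add: linext_def)

lemma linext_single: "linext f (Poly_Mapping.single w c) = smul c (f w)"
  by (cases "c = 0") (simp_all add: linext_def)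

lemma linext_one [simp]: "linext f 1 = f (0 :: 'a :: monoid_add)"
  by (simp flip: single_one)

lemma poly_mapping_sum_single:
  fixes A :: "'a \<Rightarrow>\<^sub>0 'b :: comm_monoid_add"
  shows "A = (\<Sum>w\<in>Poly_Mapping.keys A. Poly_Mapping.single w (Poly_Mapping.lookup A w))"
  by (rule poly_mapping_eqI) (auto simp: lookup_sum lookup_single when_def in_keys_iff)

lemma poly_mapping_add_induct [case_names zero single add]:
  fixes A :: "'a \<Rightarrow>\<^sub>0 'b :: comm_monoid_add"
  assumes "P 0" "\<And>w c. P (Poly_Mapping.single w c)" "\<And>A B. P A \<Longrightarrow> P B \<Longrightarrow> P (A + B)"
  shows "P A"
proof -
  have "P (\<Sum>w\<in>K. Poly_Mapping.single w (Poly_Mapping.lookup A w))" if "finite K" for K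
    using that by (induction K) (simp_all add: assms)
  then show ?thesis
    by (subst poly_mapping_sum_single) simp
qed

lemma smul_single: "smul c (Poly_Mapping.single w d) = Poly_Mapping.single w (c * d)"
  by (rule poly_mapping_eqI) (simp add: lookup_single when_def)

lemma lin_eq_linext:
  assumes "lin f"
  shows "f A = linext (\<lambda>w. f (Poly_Mapping.single w 1)) A"
  by (induction A rule: poly_mapping_add_induct)
    (simp_all add: lin_zero[OF assms] lin_add[OF assms] linext_add linext_single smul_single
      flip: lin_smul[OF assms])

text \<open>Reduces multilinear identities to basis elements, one argument at a time.\<close>

lemma lin_eqI:
  assumes "lin f" "lin g" "\<And>w. f (Poly_Mapping.single w 1) = g (Poly_Mapping.single w 1)"
  shows "f A = g A"
  using assms by (metis (no_types, lifting) ext lin_eq_linext)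

lemma linext_add_fun: "linext (\<lambda>w. f w + g w) A = linext f A + linext g A"
  by (simp add: linext_def smul.scale_right_distrib sum.distrib)

lemma linext_smul_fun: "linext (\<lambda>w. smul c (f w)) A = smul c (linext f A)"
  by (simp add: linext_def smul.scale_sum_right mult.commute)

lemma lin_linext_fun:
  assumes "\<And>w. lin (\<lambda>A. F A w)"
  shows "lin (\<lambda>A. linext (F A) B)"
proof (rule linI)
  show "linext (F (x + y)) B = linext (F x) B + linext (F y) B" for x y
    unfolding linext_add_fun[symmetric] lin_add[OF assms, symmetric] ..
  show "linext (F (smul c x)) B = smul c (linext (F x) B)" for c x
    unfolding linext_smul_fun[symmetric] lin_smul[OF assms, symmetric] ..
qed

lemma smul_mult_left: "smul c A * B = smul c (A * (B :: 'a :: monoid_add \<Rightarrow>\<^sub>0 rat))"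
proof (induction A rule: poly_mapping_add_induct)
  case (single u a)
  show ?case
    by (induction B rule: poly_mapping_add_induct)
      (simp_all add: smul_single mult_single distrib_left smul.scale_right_distrib mult_ac)
qed (simp_all add: distrib_right smul.scale_right_distrib)

lemma smul_mult_right: "A * smul c B = smul c (A * (B :: 'a :: monoid_add \<Rightarrow>\<^sub>0 rat))"
proof (induction A rule: poly_mapping_add_induct)
  case (single u a)
  show ?case
    by (induction B rule: poly_mapping_add_induct)
      (simp_all add: smul_single mult_single distrib_left smul.scale_right_distrib mult_ac)
qed (simp_all add: distrib_right smul.scale_right_distrib)

text \<open>A product of words equals \<open>c\<close> only if \<open>c\<close> is cut into these
  two words, so concatenation is dual to deconcatenation. All sums over endpoints in the final
  formula originate here.\<close>

lemma lookup_mult_word: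
  fixes A B :: ncpoly
  shows "Poly_Mapping.lookup (A * B) c =
    (\<Sum>m\<le>length c. Poly_Mapping.lookup A (take m c) * Poly_Mapping.lookup B (drop m c))"
proof (induction A rule: poly_mapping_add_induct)
  case (single u a)
  show ?case
  proof (induction B rule: poly_mapping_add_induct)
    case (single v b)
    \<comment> \<open>Only the cut after \<open>length u\<close> letters can contribute.\<close>
    have "(\<Sum>m\<le>length c. Poly_Mapping.lookup (Poly_Mapping.single u a) (take m c) *
        Poly_Mapping.lookup (Poly_Mapping.single v b) (drop m c)) =
      (\<Sum>m\<le>length c. if m = length u then (if u @ v = c then a * b else 0) else 0)"
    proof (rule sum.cong)
      fix m assume "m \<in> {..length c}"
      then have m: "m \<le> length c" by simp
      show "Poly_Mapping.lookup (Poly_Mapping.single u a) (take m c) *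
          Poly_Mapping.lookup (Poly_Mapping.single v b) (drop m c) =
        (if m = length u then (if u @ v = c then a * b else 0) else 0)"
      proof (cases "u = take m c \<and> v = drop m c")
        case True
        then have "m = length u" "u @ v = c" using m by simp_all
        with True show ?thesis by (simp add: lookup_single)
      next
        case False
        then have "\<not> (m = length u \<and> u @ v = c)" by auto
        moreover have "Poly_Mapping.lookup (Poly_Mapping.single u a) (take m c) *
            Poly_Mapping.lookup (Poly_Mapping.single v b) (drop m c) = 0"
          using False by (auto simp: lookup_single when_def)
        ultimately show ?thesis by auto
      qed
    qed simp
    moreover have "u @ v = c \<Longrightarrow> length u \<le> length c" by auto
    ultimately show ?case
      by (simp add: mult_single lookup_single when_def plus_list_def)
  qed (simp_all add: distrib_left lookup_add sum.distrib)
qed (simp_all add: distrib_right lookup_add sum.distrib)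

lemma lookup_mult_Nil: "Poly_Mapping.lookup (A * B) [] = Poly_Mapping.lookup A [] * Poly_Mapping.lookup B []"
  for A B :: ncpoly
  by (simp add: lookup_mult_word)

lemma lin_id: "lin (\<lambda>A. A)"
  by (simp add: lin_iff)

lemma lin_compose: "lin f \<Longrightarrow> lin g \<Longrightarrow> lin (\<lambda>A. f (g A))"
  by (simp add: lin_iff)

lemma lin_minus_fun: "lin f \<Longrightarrow> lin (\<lambda>A. - f A)"
  by (simp add: lin_iff)

lemma lin_diff_fun: "lin f \<Longrightarrow> lin g \<Longrightarrow> lin (\<lambda>A. f A - g A)"
  by (auto simp: lin_iff smul.scale_right_diff_distrib)

lemma lin_mult_left: "lin f \<Longrightarrow> lin (\<lambda>A. B * f A)" for B :: "'a :: monoid_add \<Rightarrow>\<^sub>0 rat"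
  by (simp add: lin_iff smul_mult_right distrib_left)

lemma lin_mult_right: "lin f \<Longrightarrow> lin (\<lambda>A. f A * B)" for B :: "'a :: monoid_add \<Rightarrow>\<^sub>0 rat"
  by (simp add: lin_iff smul_mult_left distrib_right)

lemma linext_mult_right: "linext (\<lambda>u. f u * B) A = linext f A * B"
  for B :: "'a :: monoid_add \<Rightarrow>\<^sub>0 rat"
  by (rule lin_eqI[OF lin_linext lin_mult_right[OF lin_linext]]) simp

lemma linext_mono_word: "linext (\<lambda>w. Poly_Mapping.single w 1) A = A"
  by (rule lin_eqI[OF lin_linext lin_id]) simp

section \<open>The convolution algebra\<close>

text \<open>Because letters are primitive, precomposition with left multiplication by a letter is a
  derivation of the convolution product, which gives the recursion.\<close>
fun conv :: "('a list \<Rightarrow> 'b :: ring_1) \<Rightarrow> ('a list \<Rightarrow> 'b) \<Rightarrow> 'a list \<Rightarrow> 'b" where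
  "conv f g [] = f [] * g []"
| "conv f g (a # w) = conv (\<lambda>u. f (a # u)) g w + conv f (\<lambda>u. g (a # u)) w"

text \<open>This is \<open>B\<close> times the counit; \<open>eps 1\<close> is the unit of
  convolution.\<close>

definition eps :: "'b \<Rightarrow> 'a list \<Rightarrow> 'b :: ring_1" where
  "eps B w = (if w = [] then B else 0)"

lemma eps_simps [simp]: "eps B [] = B" "eps B (a # w) = 0"
  by (simp_all add: eps_def)

lemma conv_add_left: "conv (\<lambda>u. f u + g u) h w = conv f h w + conv g h w"
  by (induction w arbitrary: f g h) (simp_all add: distrib_right)

lemma conv_add_right: "conv f (\<lambda>u. g u + h u) w = conv f g w + conv f h w"
  by (induction w arbitrary: f g h) (simp_all add: distrib_left)

lemma conv_diff_left: "conv (\<lambda>u. f u - g u) h w = conv f h w - conv g h w"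
  by (induction w arbitrary: f g h) (simp_all add: left_diff_distrib)

lemma conv_diff_right: "conv f (\<lambda>u. g u - h u) w = conv f g w - conv f h w"
  by (induction w arbitrary: f g h) (simp_all add: right_diff_distrib)

lemma conv_zero [simp]: "conv (\<lambda>u. 0) g w = 0" "conv f (\<lambda>u. 0) w = 0"
  by (induction w arbitrary: f g) simp_all

lemma conv_minus_left: "conv (\<lambda>u. - f u) h w = - conv f h w"
  using conv_diff_left[of "\<lambda>u. 0" f h w] by simp

lemma conv_sum_left: "conv (\<lambda>u. \<Sum>i\<in>I. f i u) g w = (\<Sum>i\<in>I. conv (f i) g w)"
  by (induction I rule: infinite_finite_induct) (simp_all add: conv_add_left)

lemma conv_sum_right: "conv f (\<lambda>u. \<Sum>i\<in>I. g i u) w = (\<Sum>i\<in>I. conv f (g i) w)"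
  by (induction I rule: infinite_finite_induct) (simp_all add: conv_add_right)

text \<open>Coassociativity of the coproduct: on both sides a leading letter is passed to each of
  the three factors in turn.\<close>

lemma conv_assoc: "conv (conv f g) h w = conv f (conv g h) w"
  by (induction w arbitrary: f g h) (simp_all add: mult.assoc conv_add_left conv_add_right add.assoc)

lemma conv_mult_left: "conv (\<lambda>u. B * f u) g w = B * conv f g w"
  by (induction w arbitrary: f g) (simp_all add: mult.assoc distrib_left)

lemma conv_mult_right: "conv f (\<lambda>u. g u * B) w = conv f g w * B"
  by (induction w arbitrary: f g) (simp_all add: mult.assoc distrib_right)

lemma conv_mult_middle: "conv (\<lambda>u. f u * B) g w = conv f (\<lambda>u. B * g u) w"
  by (induction w arbitrary: f g) (simp_all add: mult.assoc)

lemma conv_eps_left [simp]: "conv (eps B) g w = B * g w"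
  by (induction w arbitrary: g) simp_all

lemma conv_eps_right [simp]: "conv f (eps B) w = f w * B"
  by (induction w arbitrary: f) simp_all

lemma conv_smul_left: "conv (\<lambda>u. smul c (f u)) g w = smul c (conv f g w)"
  for f :: "'a list \<Rightarrow> 'c :: monoid_add \<Rightarrow>\<^sub>0 rat"
  by (induction w arbitrary: f g) (simp_all add: smul_mult_left smul.scale_right_distrib)

lemma conv_smul_right: "conv f (\<lambda>u. smul c (g u)) w = smul c (conv f g w)"
  for f :: "'a list \<Rightarrow> 'c :: monoid_add \<Rightarrow>\<^sub>0 rat"
  by (induction w arbitrary: f g) (simp_all add: smul_mult_right smul.scale_right_distrib)

lemma conv_lin_left:
  fixes F :: "('d \<Rightarrow>\<^sub>0 rat) \<Rightarrow> 'a list \<Rightarrow> 'c :: monoid_add \<Rightarrow>\<^sub>0 rat"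
  assumes "\<And>u. lin (\<lambda>A. F A u)"
  shows "lin (\<lambda>A. conv (F A) g w)"
proof (rule linI)
  have "F (x + y) = (\<lambda>u. F x u + F y u)" for x y
    by (rule ext) (rule lin_add[OF assms])
  then show "conv (F (x + y)) g w = conv (F x) g w + conv (F y) g w" for x y
    by (simp add: conv_add_left)
  have "F (smul c x) = (\<lambda>u. smul c (F x u))" for c x
    by (rule ext) (rule lin_smul[OF assms])
  then show "conv (F (smul c x)) g w = smul c (conv (F x) g w)" for c x
    by (simp add: conv_smul_left)
qed

lemma conv_lin_right:
  fixes F :: "('d \<Rightarrow>\<^sub>0 rat) \<Rightarrow> 'a list \<Rightarrow> 'c :: monoid_add \<Rightarrow>\<^sub>0 rat"
  assumes "\<And>u. lin (\<lambda>A. F A u)"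
  shows "lin (\<lambda>A. conv f (F A) w)"
proof (rule linI)
  have "F (x + y) = (\<lambda>u. F x u + F y u)" for x y
    by (rule ext) (rule lin_add[OF assms])
  then show "conv f (F (x + y)) w = conv f (F x) w + conv f (F y) w" for x y
    by (simp add: conv_add_right)
  have "F (smul c x) = (\<lambda>u. smul c (F x u))" for c x
    by (rule ext) (rule lin_smul[OF assms])
  then show "conv f (F (smul c x)) w = smul c (conv f (F x) w)" for c x
    by (simp add: conv_smul_right)
qed

lemma linext_mult_single:
  fixes h :: "'a :: monoid_add \<Rightarrow> 'b \<Rightarrow>\<^sub>0 rat"
  shows "linext h (Poly_Mapping.single k 1 * X) = linext (\<lambda>x. h (k + x)) X"
  by (rule lin_eqI[OF lin_compose[OF lin_linext lin_mult_left[OF lin_id]] lin_linext])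
    (simp add: mult_single)

text \<open>Justifies the recursion of \<open>conv\<close>: multiplying by the coproduct of a letter
  shifts either the first or the second component by that letter.\<close>

lemma linext_coprod_word:
  "linext (\<lambda>(u, v). f u * g v) (coprod_word w) = conv f g w"
proof (induction w arbitrary: f g)
  case Nil
  then show ?case by (simp add: zero_list_def zero_prod_def)
next
  case (Cons a w)
  have "tensor (mono_word [a]) 1 = Poly_Mapping.single ([a], []) 1"
    "tensor 1 (mono_word [a]) = Poly_Mapping.single ([], [a]) 1"
    by (simp_all add: tensor_def zero_list_def)
  then show ?case
    using Cons[of "\<lambda>u. f (a # u)" g] Cons[of f "\<lambda>u. g (a # u)"]
    by (simp add: distrib_right linext_add linext_mult_single plus_list_def case_prod_unfold)
qed

lemma sweedler_mult:
  "sweedler (\<lambda>A1 A2. f A1 * g A2) A = linext (conv (\<lambda>u. f (mono_word u)) (\<lambda>u. g (mono_word u))) A"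
proof -
  have "sweedler (\<lambda>A1 A2. f A1 * g A2) A =
     linext (\<lambda>w. linext (\<lambda>(u, v). f (mono_word u) * g (mono_word v)) (coprod_word w)) A"
    unfolding sweedler_def coprod_def
    by (rule lin_eqI[OF lin_compose[OF lin_linext lin_linext] lin_linext]) simp
  then show ?thesis
    by (simp add: linext_coprod_word[where f = "\<lambda>u. f (mono_word u)" and g = "\<lambda>u. g (mono_word u)"])
qed

text \<open>The identity \<open>Delta o phi = (phi (x) id + id (x) phi) o Delta\<close>, tested on
  words against all pairs \<open>f\<close>, \<open>g\<close>, so that only convolutions
  occur.\<close>

definition coderivation :: "(ncpoly \<Rightarrow> ncpoly) \<Rightarrow> bool" where
  "coderivation \<phi> \<longleftrightarrow> (\<forall>(f :: word \<Rightarrow> ncpoly) g w. linext (conv f g) (\<phi> (mono_word w)) =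
     conv (\<lambda>u. linext f (\<phi> (mono_word u))) g w + conv f (\<lambda>u. linext g (\<phi> (mono_word u))) w)"

lemma coderivationD:
  fixes f :: "word \<Rightarrow> ncpoly"
  shows "coderivation \<phi> \<Longrightarrow> linext (conv f g) (\<phi> (mono_word w)) =
     conv (\<lambda>u. linext f (\<phi> (mono_word u))) g w + conv f (\<lambda>u. linext g (\<phi> (mono_word u))) w"
  by (simp add: coderivation_def)

lemma linext_lin: "lin \<phi> \<Longrightarrow> linext f (\<phi> A) = linext (\<lambda>u. linext f (\<phi> (mono_word u))) A"
  by (rule lin_eq_linext[OF lin_compose[OF lin_linext]])

text \<open>In the two composites, the mixed terms with one map on each tensor factor are the same
  and cancel in the difference.\<close>

lemma coderivation_commutator:
  assumes "coderivation \<phi>" "coderivation \<psi>" "lin \<phi>" "lin \<psi>"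
  shows "coderivation (\<lambda>A. \<phi> (\<psi> A) - \<psi> (\<phi> A))"
  unfolding coderivation_def
proof (intro allI)
  fix f g :: "word \<Rightarrow> ncpoly" and w
  have *: "linext (conv f g) (\<phi> (\<psi> (mono_word w))) =
      conv (\<lambda>u. linext f (\<phi> (\<psi> (mono_word u)))) g w
      + conv (\<lambda>u. linext f (\<phi> (mono_word u))) (\<lambda>u. linext g (\<psi> (mono_word u))) w
      + conv (\<lambda>u. linext f (\<psi> (mono_word u))) (\<lambda>u. linext g (\<phi> (mono_word u))) w
      + conv f (\<lambda>u. linext g (\<phi> (\<psi> (mono_word u)))) w"
    if that: "coderivation \<phi>" "coderivation \<psi>" "lin \<phi>" for \<phi> \<psi>
  proof -
    note c = coderivationD[OF that(1)] coderivationD[OF that(2)]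
    note lin = linext_lin[OF that(3), where A = "\<psi> (mono_word u)" for u]
    show ?thesis
      unfolding lin c linext_add_fun add.assoc ..
  qed
  show "linext (conv f g) (\<phi> (\<psi> (mono_word w)) - \<psi> (\<phi> (mono_word w))) =
          conv (\<lambda>u. linext f (\<phi> (\<psi> (mono_word u)) - \<psi> (\<phi> (mono_word u)))) g w +
          conv f (\<lambda>u. linext g (\<phi> (\<psi> (mono_word u)) - \<psi> (\<phi> (mono_word u)))) w"
    unfolding linext_diff *[OF assms(1,2,3)] *[OF assms(2,1,4)] conv_diff_left conv_diff_right
    by (simp only: algebra_simps)
qed

text \<open>Expresses that Lie elements are primitive. For letters it is the recursion of
  \<open>conv\<close>; left multiplication by a bracket is a commutator of left
  multiplications.\<close>

lemma coderivation_Lie: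
  assumes "x \<in> Lie"
  shows "coderivation ((*) x)"
  using assms
proof induction
  case (letter v)
  show ?case
    by (simp add: coderivation_def mult_single plus_list_def)
next
  case (add x y)
  then show ?case
    by (simp add: coderivation_def distrib_right linext_add conv_add_left conv_add_right)
next
  case (scale x c)
  then show ?case
    by (simp add: coderivation_def smul_mult_left linext_smul conv_smul_left conv_smul_right
        smul.scale_right_distrib)
next
  case (bracket x y)
  have "coderivation (\<lambda>A. x * (y * A) - y * (x * A))"
    by (rule coderivation_commutator[of "(*) x" "(*) y"]) (fact bracket.IH | rule lin_mult_left[OF lin_id])+
  also have "(\<lambda>A. x * (y * A) - y * (x * A)) = (*) (bracket x y)"
    by (intro ext) (simp only: bracket_def left_diff_distrib mult.assoc)
  finally show ?case .
qed

lemma Lie_Nil: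
  assumes "x \<in> Lie"
  shows "Poly_Mapping.lookup x [] = 0"
  using assms
  by induction (simp_all add: lookup_single lookup_add lookup_minus lookup_mult_Nil bracket_def)

lemma Lie_zero: "0 \<in> Lie"
  using Lie.scale[OF Lie.letter, of 0] by simp

section \<open>Existence of the action\<close>

text \<open>The antipode as a function on words, the form in which \<open>conv\<close> takes its
  arguments.\<close>

definition anti :: "word \<Rightarrow> ncpoly" where
  "anti w = Poly_Mapping.single (rev w) ((- 1) ^ length w)"

definition tau :: "letter set \<Rightarrow> letter \<Rightarrow> word \<Rightarrow> ncpoly" where
  "tau V0 v = (if v \<in> V0 then eps (mono_word [v])
     else conv (\<lambda>u. anti u * mono_word [v]) mono_word)"

fun tau_word :: "letter set \<Rightarrow> word \<Rightarrow> word \<Rightarrow> ncpoly" where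
  "tau_word V0 [] = eps 1"
| "tau_word V0 (v # w) = conv (tau V0 v) (tau_word V0 w)"

definition tri :: "letter set \<Rightarrow> ncpoly \<Rightarrow> ncpoly \<Rightarrow> ncpoly" where
  "tri V0 A B = linext (\<lambda>w. linext (tau_word V0 w) A) B"

lemma one_word: "(1 :: ncpoly) = mono_word []"
  by (simp add: zero_list_def flip: single_one)

lemma mono_word_Cons: "mono_word (a # w) = mono_word [a] * mono_word w"
  by (simp add: mult_single plus_list_def)

lemma tau_word_append: "tau_word V0 (u @ w) = conv (tau_word V0 u) (tau_word V0 w)"
proof (induction u)
  case Nil
  then show ?case by (intro ext) simp
next
  case (Cons a u)
  then show ?case by (intro ext) (simp add: conv_assoc)
qed

lemma tri_lin_right: "lin (\<lambda>B. tri V0 A B)"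
  unfolding tri_def by (rule lin_linext)

lemma tri_lin_left: "lin (\<lambda>A. tri V0 A B)"
  by (rule linI) (simp_all add: tri_def linext_add linext_smul linext_add_fun linext_smul_fun)

lemma tri_mono [simp]: "tri V0 (mono_word u) (mono_word w) = tau_word V0 w u"
  by (simp add: tri_def)

lemma tri_letter: "tri V0 A (mono_word [v]) = linext (tau V0 v) A"
proof -
  have "tau_word V0 [v] = tau V0 v" by (intro ext) simp
  then show ?thesis by (simp add: tri_def)
qed

lemma tau_word_Nil: "tau_word V0 w [] = mono_word w"
proof (induction w)
  case (Cons v w)
  then show ?case
    by (simp add: tau_def anti_def mult_single plus_list_def)
qed (simp add: one_word)

lemma tri_one_left: "tri V0 1 A = A"
  by (rule lin_eqI[OF tri_lin_right lin_id]) (simp add: one_word tau_word_Nil)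

text \<open>For words \<open>B\<close> and \<open>C\<close> this is \<open>tau_word_append\<close>;
  the rest is linearity, first in \<open>C\<close>, then in \<open>B\<close>.\<close>

lemma tri_mult: "tri V0 A (B * C) = sweedler (\<lambda>A1 A2. tri V0 A1 B * tri V0 A2 C) A"
proof -
  have 1: "tri V0 A (mono_word u * mono_word w) =
      linext (conv (\<lambda>a. tri V0 (mono_word a) (mono_word u)) (\<lambda>a. tri V0 (mono_word a) (mono_word w))) A" for u w
    by (simp add: mult_single plus_list_def tau_word_append) (simp add: tri_def tau_word_append)
  have 2: "tri V0 A (mono_word u * C) =
      linext (conv (\<lambda>a. tri V0 (mono_word a) (mono_word u)) (\<lambda>a. tri V0 (mono_word a) C)) A" for u
    by (rule lin_eqI[where A = C]) (rule lin_compose[OF tri_lin_right lin_mult_left[OF lin_id]],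
      rule lin_linext_fun, rule conv_lin_right, rule tri_lin_right, rule 1)
  show ?thesis
    unfolding sweedler_mult
    by (rule lin_eqI[where A = B]) (rule lin_compose[OF tri_lin_right lin_mult_right[OF lin_id]],
      rule lin_linext_fun, rule conv_lin_left, rule tri_lin_right, rule 2)
qed

text \<open>A Lie element has coproduct \<open>x (x) 1 + 1 (x) x\<close>, which is the coderivation
  property at the empty word. The disjunction lets existence and uniqueness share the
  argument.\<close>

lemma enveloping_derivation:
  assumes T: "is_enveloping_extension T \<or> T = tri V0" and x: "x \<in> Lie"
  shows "T x (B * C) = T x B * C + B * T x C"
proof -
  have lin: "lin (\<lambda>A. T A D)" and one: "T 1 D = D"
    and mult: "T x (B * C) = sweedler (\<lambda>A1 A2. T A1 B * T A2 C) x" for D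
    using T by (auto simp: is_enveloping_extension_def is_bilinear_def tri_lin_left tri_one_left tri_mult)
  have [simp]: "T (mono_word []) D = D" for D
    using one by (simp add: one_word)
  show ?thesis
    using coderivationD[OF coderivation_Lie[OF x], of "\<lambda>u. T (mono_word u) B" "\<lambda>u. T (mono_word u) C" "[]"]
    unfolding mult sweedler_mult by (simp add: lin_eq_linext[OF lin, symmetric] one flip: one_word)
qed

lemmas tri_derivation = enveloping_derivation[OF disjI2[OF refl]]

lemma linext_eps: "linext (eps B) A = smul (Poly_Mapping.lookup A []) B" for A B :: ncpoly
  by (rule lin_eqI[OF lin_linext]) (auto simp: lin_iff lookup_add smul.scale_left_distrib eps_def lookup_single)

lemma Lie_eps:
  assumes "x \<in> Lie"
  shows "linext (eps B) (x * A) = (0 :: ncpoly)" "linext (eps B) x = (0 :: ncpoly)"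
proof -
  show "linext (eps B) (x * A) = 0" "linext (eps B) x = 0"
    by (simp_all add: linext_eps lookup_mult_Nil Lie_Nil[OF assms])
qed

lemma tri_one_right:
  assumes "x \<in> Lie"
  shows "tri V0 x 1 = 0"
  by (simp add: one_word tri_def Lie_eps[OF assms])

text \<open>The antipode reverses products and is \<open>-1\<close> on letters, hence on all Lie
  elements.\<close>

lemma anti_Lie:
  assumes "x \<in> Lie"
  shows "linext anti (x * mono_word u) = - (anti u * x)"
proof -
  have mult: "linext anti (A * B) = linext anti B * linext anti A" for A B
  proof -
    have 1: "linext anti (mono_word u * B) = linext anti B * anti u" for u
      by (rule lin_eqI[OF lin_compose[OF lin_linext lin_mult_left[OF lin_id]] lin_mult_right[OF lin_linext]])
        (simp add: mult_single plus_list_def anti_def power_add mult.commute)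
    show ?thesis
      by (rule lin_eqI[OF lin_compose[OF lin_linext lin_mult_right[OF lin_id]] lin_mult_left[OF lin_linext]])
        (simp add: 1)
  qed
  have "anti [v] = - mono_word [v]" for v
    by (simp add: anti_def single_uminus)
  then have "linext anti x = - x"
    using assms(1)
    by (induction rule: Lie.induct[OF assms]) (simp_all add: linext_add linext_smul linext_diff bracket_def mult single_uminus)
  then show ?thesis by (simp add: mult)
qed

text \<open>As \<open>x\<close> is primitive, the antipode term \<open>S(x) v = - x v\<close> and
  the identity term \<open>v x\<close> add up to the bracket.\<close>

lemma tri_letter_Lie:
  assumes "x \<in> Lie"
  shows "tri V0 x (mono_word [v]) = (if v \<in> V0 then 0 else bracket (mono_word [v]) x)"
proof (cases "v \<in> V0")
  case True
  then show ?thesis by (simp add: tri_letter tau_def Lie_eps[OF assms])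
next
  case False
  have "linext (\<lambda>u. anti u * B) x = - (x * B)" for B
  proof -
    have "linext (\<lambda>u. anti u * B) x = linext anti x * B"
      by (rule linext_mult_right)
    also have "linext anti x = - x"
      using anti_Lie[OF assms, of "[]"] by (simp add: anti_def flip: one_word)
    finally show ?thesis by simp
  qed
  moreover have "anti [] = 1"
    by (simp add: anti_def one_word)
  ultimately have "linext (conv (\<lambda>u. anti u * mono_word [v]) mono_word) x = mono_word [v] * x - x * mono_word [v]"
    using coderivationD[OF coderivation_Lie[OF assms], of "\<lambda>u. anti u * mono_word [v]" mono_word "[]"]
    by (simp add: linext_mono_word flip: one_word)
  then show ?thesis
    using False by (simp add: tri_letter tau_def bracket_def)
qed

text \<open>A derivation of the associative product respects brackets, so its values on letters
  decide whether it preserves \<open>Lie\<close>.\<close>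

lemma Lie_derivation:
  assumes lin: "lin D" and mult: "\<And>B C. D (B * C) = D B * C + B * D C"
    and letter: "\<And>v. D (mono_word [v]) \<in> Lie"
  shows "lie_derivation D"
proof -
  have "D x \<in> Lie" if "x \<in> Lie" for x
    using that
  proof induction
    case (bracket x y)
    have "D (bracket x y) = bracket (D x) y + bracket x (D y)"
      by (simp add: bracket_def lin_diff[OF lin] mult algebra_simps)
    then show ?case using bracket by (simp add: Lie.add Lie.bracket)
  qed (simp_all add: letter lin_add[OF lin] lin_smul[OF lin] Lie.add Lie.scale)
  then show ?thesis
    by (simp add: lie_derivation_def bracket_def lin_add[OF lin] lin_smul[OF lin] lin_diff[OF lin] mult algebra_simps)
qed

lemma tri_post_lie: "is_post_lie_product_I V0 (tri V0)"
  unfolding is_post_lie_product_I_def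
  by (auto simp: tri_letter_Lie Lie_zero intro!: Lie_derivation tri_lin_right tri_derivation Lie.bracket Lie.letter)

lemma tri_Lie_closed: "x \<in> Lie \<Longrightarrow> y \<in> Lie \<Longrightarrow> tri V0 x y \<in> Lie"
  using tri_post_lie unfolding is_post_lie_product_I_def lie_derivation_def by blast

text \<open>Induction on the word: \<open>D (a w) = D a * w + a * D w\<close>, where
  \<open>D a\<close> is a Lie element, so left multiplication by it is a coderivation
  already.\<close>

lemma tri_coderivation:
  assumes x: "x \<in> Lie"
  shows "coderivation (tri V0 x)"
  unfolding coderivation_def
proof (intro allI)
  fix f g :: "word \<Rightarrow> ncpoly" and w
  define D where "D = tri V0 x"
  have D: "lin D" unfolding D_def by (rule tri_lin_right)
  show "linext (conv f g) (tri V0 x (mono_word w)) =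
          conv (\<lambda>u. linext f (tri V0 x (mono_word u))) g w +
          conv f (\<lambda>u. linext g (tri V0 x (mono_word u))) w"
    unfolding D_def[symmetric]
  proof (induction w arbitrary: f g)
    case Nil
    then show ?case using tri_one_right[OF x] by (simp add: D_def flip: one_word)
  next
    case (Cons a w)
    have a: "coderivation ((*) (D (mono_word [a])))"
      unfolding D_def by (intro coderivation_Lie tri_Lie_closed Lie.letter x)
    \<comment> \<open>The summand \<open>a * D w\<close> becomes a shift of \<open>f\<close> by
      \<open>a\<close>, which matches the recursion of \<open>conv\<close>.\<close>
    have Lf: "linext f (D (mono_word (a # w))) =
        linext f (D (mono_word [a]) * mono_word w) + linext (\<lambda>u. f (a # u)) (D (mono_word w))"
      for f :: "word \<Rightarrow> ncpoly" and w
      unfolding mono_word_Cons[of a w] D_def tri_derivation[OF x]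
      by (simp add: linext_add linext_mult_single plus_list_def)
    have "(\<lambda>u. conv f g (a # u)) = (\<lambda>u. conv (\<lambda>u. f (a # u)) g u + conv f (\<lambda>u. g (a # u)) u)"
      by simp
    then show ?case
      by (simp add: Lf coderivationD[OF a] linext_add_fun Cons conv_add_left conv_add_right)
  qed
qed

text \<open>A derivation sending letters to Lie elements commutes with the antipode, which negates
  both the letters and their images.\<close>

lemma tri_anti:
  assumes x: "x \<in> Lie"
  shows "linext anti (tri V0 x (mono_word u)) = tri V0 x (anti u)"
proof -
  have D: "lin (tri V0 x)" by (rule tri_lin_right)
  show ?thesis
  proof (induction u)
    case Nil
    then show ?case using tri_one_right[OF x] by (simp add: anti_def flip: one_word)
  next
    case (Cons a u)
    have a: "anti (a # u) = - (anti u * mono_word [a])" for u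
      by (simp add: anti_def mult_single plus_list_def single_uminus)
    have "linext anti (mono_word [a] * A) = - (linext anti A * mono_word [a])" for A
      by (simp add: linext_mult_single plus_list_def a)
         (rule lin_eqI[OF lin_linext lin_minus_fun[OF lin_mult_right[OF lin_linext]]], simp)
    then show ?case
      unfolding mono_word_Cons[of a u] tri_derivation[OF x] linext_add
      by (simp add: anti_Lie tri_Lie_closed x Lie.letter Cons a lin_minus[OF D] tri_derivation[OF x])
  qed
qed

lemma derivation_conv:
  assumes "lin D" "\<And>B C. D (B * C) = D B * C + B * D C"
  shows "D (conv f g w) = conv (\<lambda>u. D (f u)) g w + conv f (\<lambda>u. D (g u)) w"
  by (induction w arbitrary: f g) (simp_all add: assms(2) lin_add[OF assms(1)])

lemma tri_Lie_Nil:
  assumes x: "x \<in> Lie"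
  shows "Poly_Mapping.lookup (tri V0 x (mono_word w)) [] = 0"
proof (induction w)
  case Nil
  then show ?case using tri_one_right[OF x] by (simp flip: one_word)
next
  case (Cons a w)
  then show ?case
    unfolding mono_word_Cons[of a w] tri_derivation[OF x]
    by (simp add: lookup_add lookup_mult_Nil Lie_Nil tri_Lie_closed x Lie.letter)
qed

text \<open>The extension axiom asks for this with Lie \<open>B\<close> only; for arbitrary
  \<open>B\<close> it can be built up letter by letter along convolution products.\<close>

lemma tri_Lie_mult_left:
  assumes x: "x \<in> Lie"
  shows "tri V0 (x * A) B = tri V0 x (tri V0 A B) - tri V0 (tri V0 x A) B"
proof -
  define D where "D = tri V0 x"
  have D: "lin D" unfolding D_def by (rule tri_lin_right)
  have D_mult: "D (B * C) = D B * C + B * D C" for B C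
    unfolding D_def by (rule tri_derivation[OF x])
  \<comment> \<open>Both sides are derivations of the convolution product, so letters suffice.\<close>
  define good where "good f \<longleftrightarrow> (\<forall>u. linext f (x * mono_word u) = D (f u) - linext f (D (mono_word u)))" for f
  have x_co: "coderivation ((*) x)" by (rule coderivation_Lie[OF x])
  have D_co: "coderivation D" unfolding D_def by (rule tri_coderivation[OF x])
  have conv: "good (conv f g)" if "good f" "good g" for f g
    using that unfolding good_def
    by (simp add: coderivationD[OF x_co] coderivationD[OF D_co] conv_diff_left conv_diff_right
        derivation_conv[OF D D_mult])
  have eps: "good (eps B)" if "D B = 0" for B
    by (auto simp: good_def Lie_eps[OF x] linext_eps D_def tri_Lie_Nil[OF x] lookup_mult_Nil Lie_Nil[OF x] eps_def that[unfolded D_def]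
        lin_zero[OF D, unfolded D_def])
  have tau: "good (tau V0 v)" for v
  proof (cases "v \<in> V0")
    case True
    then show ?thesis by (simp add: tau_def eps D_def tri_letter_Lie[OF x])
  next
    case False
    have D_anti: "linext anti (D (mono_word u)) = D (anti u)" for u
      unfolding D_def by (rule tri_anti[OF x])
    have Dv: "D (mono_word [v]) = mono_word [v] * x - x * mono_word [v]"
      using False by (simp add: D_def tri_letter_Lie[OF x] bracket_def)
    show ?thesis
      \<comment> \<open>The contributions of \<open>D\<close> applied to \<open>u\<close> cancel by
        \<open>D_anti\<close>, leaving \<open>anti u * D v\<close>. In
        \<open>D v = v x - x v\<close> the factor \<open>x\<close> after \<open>v\<close> is carried
        into the second convolution factor, which gives the left side.\<close>
      unfolding good_def tau_def using False
      by (simp add: coderivationD[OF x_co] coderivationD[OF D_co] derivation_conv[OF D D_mult]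
          linext_mult_right linext_mono_word D_mult Dv D_anti anti_Lie[OF x] conv_minus_left conv_diff_left
          conv_add_left conv_add_right conv_diff_right left_diff_distrib right_diff_distrib
          distrib_left distrib_right conv_mult_middle mult.assoc)
  qed
  have D1: "D 1 = 0" unfolding D_def by (rule tri_one_right[OF x])
  have tau_word: "good (tau_word V0 w)" for w
    by (induction w) (simp_all add: eps D1 tau conv)
  have 1: "tri V0 (x * mono_word u) B = D (tri V0 (mono_word u) B) - tri V0 (D (mono_word u)) B" for u
    by (rule lin_eqI[where A = B, OF tri_lin_right lin_diff_fun[OF lin_compose[OF D tri_lin_right] tri_lin_right]])
      (use tau_word in \<open>simp add: tri_def good_def\<close>)
  show ?thesis
    unfolding D_def[symmetric]
    by (rule lin_eqI[where A = A, OF lin_compose[OF tri_lin_left lin_mult_left[OF lin_id]]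
        lin_diff_fun[OF lin_compose[OF D tri_lin_left] lin_compose[OF tri_lin_left D]] 1])
qed

lemma tri_enveloping: "is_enveloping_extension (tri V0)"
  unfolding is_enveloping_extension_def is_bilinear_def
  by (simp add: tri_lin_left tri_lin_right tri_one_right tri_one_left tri_Lie_mult_left tri_mult)

section \<open>Uniqueness of the action\<close>

text \<open>In \<open>xA \<triangleright> y = x \<triangleright> (A \<triangleright> y) - (x \<triangleright> A) \<triangleright> y\<close> the word length of \<open>x \<triangleright> A\<close> can be that of \<open>xA\<close>;
  the recursion ends because the number of Lie factors drops.\<close>
inductive Lie_product :: "nat \<Rightarrow> ncpoly \<Rightarrow> bool" where
  zero: "Lie_product m 0"
| add: "Lie_product m A \<Longrightarrow> Lie_product m B \<Longrightarrow> Lie_product m (A + B)"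
| one: "Lie_product 0 1"
| mult: "x \<in> Lie \<Longrightarrow> Lie_product m A \<Longrightarrow> Lie_product (Suc m) (x * A)"

text \<open>The derivation replaces one Lie factor by another, so their number is kept.\<close>

lemma Lie_product_tri:
  assumes x: "x \<in> Lie" and "Lie_product m A"
  shows "Lie_product m (tri V0 x A)"
  using assms(2)
proof induction
  case (mult y m A)
  then show ?case
    unfolding tri_derivation[OF x] by (intro Lie_product.add Lie_product.mult tri_Lie_closed x)
qed (simp_all add: tri_one_right[OF x] lin_zero[OF tri_lin_right] lin_add[OF tri_lin_right]
  Lie_product.zero Lie_product.add)

lemma Lie_product_word: "Lie_product (length w) (mono_word w)"
proof (induction w)
  case Nil
  then show ?case by (simp add: Lie_product.one flip: one_word)
next
  case (Cons a w)
  then show ?case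
    unfolding mono_word_Cons[of a w] by (simp add: Lie_product.mult Lie.letter)
qed

text \<open>The letters of \<open>w\<close> are distributed over the two factors; with fewer than
  \<open>p + q\<close> of them, one factor falls below its bound.\<close>

lemma conv_vanish:
  assumes "\<And>u. length u < p \<Longrightarrow> f u = 0" "\<And>u. length u < q \<Longrightarrow> g u = 0" "length w < p + q"
  shows "conv f g w = 0"
  using assms
proof (induction w arbitrary: f g p q)
  case Nil
  then show ?case by (cases p) auto
next
  case (Cons a w)
  have "conv (\<lambda>u. f (a # u)) g w = 0"
  proof (cases p)
    case 0
    then show ?thesis using Cons.prems by (intro Cons.IH[of 0 _ q]) simp_all
  next
    case (Suc p')
    then show ?thesis using Cons.prems by (intro Cons.IH[of p' _ q]) simp_all
  qed
  moreover have "conv f (\<lambda>u. g (a # u)) w = 0"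
  proof (cases q)
    case 0
    then show ?thesis using Cons.prems by (intro Cons.IH[of p _ 0]) simp_all
  next
    case (Suc q')
    then show ?thesis using Cons.prems by (intro Cons.IH[of p _ q']) simp_all
  qed
  ultimately show ?case by simp
qed

text \<open>The difference \<open>g\<close> to the unit satisfies \<open>g * g = - g\<close> under
  convolution. If \<open>g\<close> vanishes up to length \<open>n\<close>, its square vanishes up to
  length \<open>n + 1\<close>, hence so does \<open>g\<close>.\<close>

lemma conv_idempotent:
  assumes idem: "\<And>u. conv f f u = f u" and one: "f [] = 1"
  shows "f = eps 1"
proof -
  define g where "g u = f u - eps 1 u" for u
  have g: "conv g g u = - g u" for u
    by (simp add: g_def[abs_def] conv_diff_left conv_diff_right idem)
  have "\<forall>u. length u < Suc n \<longrightarrow> g u = 0" for n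
  proof (induction n)
    case 0
    then show ?case by (simp add: g_def one)
  next
    case (Suc n)
    then have "conv g g u = 0" if "length u < Suc (Suc n)" for u
      using that by (intro conv_vanish[of "Suc n" g "Suc n" g]) auto
    then show ?case by (simp add: g)
  qed
  then have "g u = 0" for u by blast
  then show ?thesis by (auto simp: g_def)
qed

text \<open>Agreement is shown for Lie elements acting on everything, then for everything acting on
  letters, then on \<open>1\<close>, and finally on words by multiplicativity.\<close>

lemma tri_unique:
  assumes post: "is_post_lie_product_I V0 T" and env: "is_enveloping_extension T"
  shows "T = tri V0"
proof -
  have linR: "lin (T A)" and linL: "lin (\<lambda>A. T A B)" for A B
    using env by (auto simp: is_enveloping_extension_def is_bilinear_def)
  have T_one: "T 1 A = A" for A
    using env by (simp add: is_enveloping_extension_def)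
  have T_mult: "T A (B * C) = linext (conv (\<lambda>u. T (mono_word u) B) (\<lambda>u. T (mono_word u) C)) A" for A B C
    using env unfolding is_enveloping_extension_def sweedler_mult by blast
  have T_Lie: "T x B = tri V0 x B" if x: "x \<in> Lie" for x B
  proof (rule lin_eqI[OF linR tri_lin_right])
    fix w
    show "T x (mono_word w) = tri V0 x (mono_word w)"
    proof (induction w)
      case Nil
      then show ?case
        using env x by (simp add: tri_one_right is_enveloping_extension_def flip: one_word)
    next
      case (Cons a w)
      have "T x (mono_word [a]) = tri V0 x (mono_word [a])"
        using post x by (simp add: is_post_lie_product_I_def tri_letter_Lie)
      then show ?case
        unfolding mono_word_Cons[of a w] enveloping_derivation[OF disjI1[OF env] x]
        by (simp only: Cons tri_derivation[OF x])
    qed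
  qed
  have letter: "T A (mono_word [v]) = tri V0 A (mono_word [v])" if "Lie_product m A" for m A v
    using that
  proof (induction m arbitrary: A v)
    case 0
    from 0 show ?case
      by (induction "0 :: nat" A rule: Lie_product.induct)
        (simp_all add: lin_zero[OF linL] lin_zero[OF tri_lin_left] lin_add[OF linL]
          lin_add[OF tri_lin_left] T_one tri_one_left)
  next
    case (Suc m)
    note IH = Suc.IH
    from Suc.prems show ?case
    proof (induction "Suc m" A rule: Lie_product.induct)
      case (mult x A)
      \<comment> \<open>Here \<open>T x A\<close> equals \<open>tri V0 x A\<close> and has
        \<open>m\<close> Lie factors, so the induction hypothesis applies to it as well as to
        \<open>A\<close>.\<close>
      have "T (x * A) (mono_word [v]) = T x (T A (mono_word [v])) - T (T x A) (mono_word [v])"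
        using env mult by (simp add: is_enveloping_extension_def Lie.letter)
      then show ?case
        using mult by (simp add: tri_Lie_mult_left T_Lie IH Lie_product_tri)
    qed (simp_all add: lin_zero[OF linL] lin_zero[OF tri_lin_left] lin_add[OF linL]
          lin_add[OF tri_lin_left])
  qed
  \<comment> \<open>The axioms prescribe the action on \<open>1\<close> only for Lie elements and
    for \<open>1\<close> itself; \<open>1 = 1 * 1\<close> makes it idempotent under
    convolution.\<close>
  have "(\<lambda>u. T (mono_word u) 1) = eps 1"
  proof (rule conv_idempotent)
    show "conv (\<lambda>u. T (mono_word u) 1) (\<lambda>u. T (mono_word u) 1) u = T (mono_word u) 1" for u
      using T_mult[of "mono_word u" 1 1] by simp
  qed (simp add: T_one flip: one_word)
  then have one: "T (mono_word u) 1 = eps 1 u" for u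
    by metis
  have word: "T (mono_word u) (mono_word w) = tri V0 (mono_word u) (mono_word w)" for u w
  proof (induction w arbitrary: u)
    case Nil
    then show ?case
      unfolding tri_mono using one by (simp flip: one_word)
  next
    case (Cons a w)
    have "T (mono_word u) (mono_word [a]) = tau V0 a u" for u
      using letter[OF Lie_product_word] by (simp add: tri_letter)
    then show ?case
      unfolding mono_word_Cons[of a w] T_mult
      unfolding mono_word_Cons[of a w, symmetric] by (simp add: Cons)
  qed
  have "T A B = tri V0 A B" for A B
  proof (rule lin_eqI[OF linL tri_lin_left])
    show "T (mono_word u) B = tri V0 (mono_word u) B" for u
      by (rule lin_eqI[OF linR tri_lin_right word])
  qed
  then show ?thesis by (intro ext)
qed

section \<open>The Grossman--Larson product and its dual coproduct\<close>

lemma tri_I_eq: "tri_I V0 = tri V0"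
  unfolding tri_I_def
  by (rule the_equality) (use tri_post_lie tri_enveloping tri_unique in blast)+

lemma gl_I_eq: "gl_I V0 A B = linext (conv mono_word (\<lambda>u. tri V0 (mono_word u) B)) A"
  unfolding gl_I_def tri_I_eq by (rule sweedler_mult)

lemma gl_I_word: "gl_I V0 (mono_word u) (mono_word w) = conv mono_word (tau_word V0 w) u"
  by (simp add: gl_I_eq)

lemma gl_I_lin: "lin (\<lambda>A. gl_I V0 A B)" "lin (gl_I V0 A)"
  unfolding gl_I_eq by (rule lin_linext, rule lin_linext_fun, rule conv_lin_right, rule tri_lin_right)

lemma tensor_lin: "lin (\<lambda>A. tensor A B)" "lin (tensor A)"
  unfolding tensor_def by (rule lin_linext, rule lin_linext_fun, rule lin_linext)

lemma pairing_superset: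
  assumes "finite K" "Poly_Mapping.keys A \<subseteq> K"
  shows "pairing A B = (\<Sum>w\<in>K. Poly_Mapping.lookup A w * Poly_Mapping.lookup B w)"
  unfolding pairing_def by (rule sum.mono_neutral_left) (use assms in \<open>auto simp: in_keys_iff\<close>)

lemma pairing_add_left: "pairing (A + B) C = pairing A C + pairing B C"
proof -
  let ?K = "Poly_Mapping.keys A \<union> Poly_Mapping.keys B"
  show ?thesis
    using pairing_superset[of ?K "A + B" C] pairing_superset[of ?K A C] pairing_superset[of ?K B C]
    by (simp add: Poly_Mapping.keys_add lookup_add distrib_right sum.distrib)
qed

lemma pairing_smul_left: "pairing (smul c A) B = c * pairing A B"
proof -
  have "Poly_Mapping.keys (smul c A) \<subseteq> Poly_Mapping.keys A"
    by (auto simp: in_keys_iff)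
  then show ?thesis
    using pairing_superset[of "Poly_Mapping.keys A" "smul c A" B]
    by (simp add: pairing_def sum_distrib_left mult.assoc)
qed

lemma pairing_mono_left [simp]: "pairing (Poly_Mapping.single w 1) A = Poly_Mapping.lookup A w"
  by (simp add: pairing_def)

lemma pairing_mono_right [simp]: "pairing A (Poly_Mapping.single w 1) = Poly_Mapping.lookup A w"
  by (simp add: pairing_def lookup_single when_def in_keys_iff if_distrib[where f = "(*) x" for x] cong: if_cong)

text \<open>Counterpart of \<open>lin_eqI\<close> for scalar values, which \<open>lin\<close> does
  not cover.\<close>

lemma pairing_eqI:
  assumes "lin F" "lin G" "\<And>w. pairing (F (Poly_Mapping.single w 1)) X = pairing (G (Poly_Mapping.single w 1)) Y"
  shows "pairing (F A) X = pairing (G A) Y"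
proof (induction A rule: poly_mapping_add_induct)
  case zero
  show ?case by (simp add: lin_zero[OF assms(1)] lin_zero[OF assms(2)] pairing_def)
next
  case (single w c)
  have "Poly_Mapping.single w c = smul c (Poly_Mapping.single w 1)"
    by (simp add: smul_single)
  then show ?case by (simp add: lin_smul[OF assms(1)] lin_smul[OF assms(2)] pairing_smul_left assms(3))
qed (simp add: lin_add[OF assms(1)] lin_add[OF assms(2)] pairing_add_left)

lemma tensor_mono: "tensor (mono_word u) (mono_word w) = Poly_Mapping.single (u, w) 1"
  by (simp add: tensor_def)

text \<open>Pairing with pairs of words reads off all coefficients, so the dual element is unique,
  and checking a candidate on words suffices.\<close>

lemma Delta_I_word:
  assumes "\<And>u w. Poly_Mapping.lookup X (u, w) = Poly_Mapping.lookup (conv mono_word (tau_word V0 w) u) c"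
  shows "Delta_I V0 (mono_word c) = X"
  unfolding Delta_I_def
proof (rule the_equality)
  show "\<forall>A B. pairing (gl_I V0 A B) (mono_word c) = pairing (tensor A B) X"
  proof (intro allI)
    fix A B
    show "pairing (gl_I V0 A B) (mono_word c) = pairing (tensor A B) X"
      by (rule pairing_eqI[where A = A, OF gl_I_lin(1) tensor_lin(1)],
        rule pairing_eqI[where A = B, OF gl_I_lin(2) tensor_lin(2)])
        (simp add: gl_I_word tensor_mono assms)
  qed
next
  fix Y assume Y: "\<forall>A B. pairing (gl_I V0 A B) (mono_word c) = pairing (tensor A B) Y"
  show "Y = X"
  proof (rule poly_mapping_eqI)
    fix k :: "word \<times> word"
    obtain u w where "k = (u, w)" by (cases k)
    then show "Poly_Mapping.lookup Y k = Poly_Mapping.lookup X k"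
      using Y[rule_format, of "mono_word u" "mono_word w"] by (simp add: gl_I_word tensor_mono assms)
  qed
qed

section \<open>Coefficients of the Grossman--Larson product\<close>

text \<open>The convolutions on the right are scalar-valued: the target product is resolved into
  cuts of \<open>c\<close>, while the coproduct of \<open>u\<close> remains.\<close>

lemma lookup_conv:
  fixes f g :: "word \<Rightarrow> ncpoly"
  shows "Poly_Mapping.lookup (conv f g u) c = (\<Sum>m\<le>length c.
    conv (\<lambda>u. Poly_Mapping.lookup (f u) (take m c)) (\<lambda>u. Poly_Mapping.lookup (g u) (drop m c)) u)"
  by (induction u arbitrary: f g) (simp_all add: lookup_mult_word lookup_add sum.distrib)

lemma lookup_letter_mult:
  "Poly_Mapping.lookup (mono_word [x] * A) [] = 0"
  "Poly_Mapping.lookup (mono_word [x] * A) (a # w) = (if x = a then Poly_Mapping.lookup A w else 0)"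
proof -
  show "Poly_Mapping.lookup (mono_word [x] * A) [] = 0"
    by (simp add: lookup_mult_Nil lookup_single)
  show "Poly_Mapping.lookup (mono_word [x] * A) (a # w) = (if x = a then Poly_Mapping.lookup A w else 0)"
    by (induction A rule: poly_mapping_add_induct)
      (auto simp: distrib_left lookup_add mult_single plus_list_def lookup_single when_def)
qed

lemma lookup_mult_letter:
  "Poly_Mapping.lookup (A * mono_word [x]) [] = 0"
  "Poly_Mapping.lookup (A * mono_word [x]) (w @ [a]) = (if a = x then Poly_Mapping.lookup A w else 0)"
proof -
  show "Poly_Mapping.lookup (A * mono_word [x]) [] = 0"
    by (simp add: lookup_mult_Nil lookup_single)
  show "Poly_Mapping.lookup (A * mono_word [x]) (w @ [a]) = (if a = x then Poly_Mapping.lookup A w else 0)"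
    by (induction A rule: poly_mapping_add_induct)
      (auto simp: distrib_right lookup_add mult_single plus_list_def lookup_single when_def)
qed

lemma lookup_mono_Nil: "Poly_Mapping.lookup (mono_word []) = eps 1"
  by (rule ext) (auto simp: lookup_single eps_def when_def)

lemma lookup_mono_Cons:
  "(\<lambda>w. Poly_Mapping.lookup (mono_word (x # u)) (a # w)) =
   (if x = a then Poly_Mapping.lookup (mono_word u) else (\<lambda>w. 0))"
  by (rule ext) (auto simp: lookup_single when_def)

text \<open>Shuffle product and coproduct are dual: removing the first letter of \<open>w\<close>
  leads to the same recursion on both sides.\<close>

lemma lookup_shuffle_word:
  "Poly_Mapping.lookup (shuffle_word u v) w =
    conv (Poly_Mapping.lookup (mono_word u)) (Poly_Mapping.lookup (mono_word v)) w"
proof (induction u v arbitrary: w rule: shuffle_word.induct)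
  case (3 x u y v)
  show ?case
  proof (cases w)
    case Nil
    then show ?thesis by (simp add: lookup_add lookup_letter_mult) (simp add: lookup_single)
  next
    case (Cons a w')
    then show ?thesis
      using 3[of w'] by (auto simp: lookup_add lookup_letter_mult lookup_mono_Cons)
  qed
qed (simp_all add: lookup_mono_Nil)

lemma lookup_shuffle:
  "Poly_Mapping.lookup (shuffle A B) w = conv (Poly_Mapping.lookup A) (Poly_Mapping.lookup B) w"
proof -
  have add: "Poly_Mapping.lookup (A + B) = (\<lambda>w. Poly_Mapping.lookup A w + Poly_Mapping.lookup B w)" for A B :: ncpoly
    by (rule ext) (simp add: lookup_add)
  \<comment> \<open>The scalar is placed on the outer side, right for the second and left for the
    first convolution factor, where it can be pulled out.\<close>
  have scale_right: "Poly_Mapping.lookup (Poly_Mapping.single u c) = (\<lambda>w. Poly_Mapping.lookup (mono_word u) w * c)" for u and c :: rat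
    by (rule ext) (simp add: lookup_single when_def)
  have scale_left: "Poly_Mapping.lookup (Poly_Mapping.single u c) = (\<lambda>w. c * Poly_Mapping.lookup (mono_word u) w)" for u and c :: rat
    by (rule ext) (simp add: lookup_single when_def)
  have zero: "Poly_Mapping.lookup (0 :: ncpoly) = (\<lambda>w. 0)"
    by (rule ext) simp
  have 1: "Poly_Mapping.lookup (linext (shuffle_word u) B) w =
      conv (Poly_Mapping.lookup (mono_word u)) (Poly_Mapping.lookup B) w" for u
  proof (induction B rule: poly_mapping_add_induct)
    case (single v c)
    show ?case
      unfolding scale_right[of _ c] conv_mult_right
      by (simp add: linext_single lookup_shuffle_word mult.commute)
  qed (simp_all add: linext_add add zero conv_add_right)
  show ?thesis
    unfolding shuffle_def
  proof (induction A rule: poly_mapping_add_induct)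
    case (single v c)
    show ?case
      unfolding scale_left[of _ c] conv_mult_left
      by (simp add: linext_single 1)
  qed (simp_all add: linext_add add zero conv_add_left)
qed

lemma antipode_mono: "antipode (mono_word w) = anti w"
  by (simp add: antipode_def anti_def)

text \<open>The antipode is self-adjoint for the pairing; this turns a coefficient at a fixed word
  \<open>d\<close> into a functional of the acting word \<open>u\<close>.\<close>

lemma lookup_anti_commute: "Poly_Mapping.lookup (anti u) d = Poly_Mapping.lookup (anti d) u"
  by (auto simp: anti_def lookup_single when_def)

lemma II_notin: "v \<notin> V0 \<Longrightarrow> II V0 A v = A"
  unfolding II_def by (rule lin_eqI[OF lin_linext lin_id]) simp

lemma lookup_II_in:
  assumes "v \<in> V0"
  shows "Poly_Mapping.lookup (II V0 A v) u = (if u = [] then Poly_Mapping.lookup A [] else 0)"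
  unfolding II_def using assms
  by (induction A rule: poly_mapping_add_induct)
    (auto simp: linext_add lookup_add linext_single lookup_single when_def)

text \<open>Each occurrence of \<open>v\<close> in \<open>c\<close> splits \<open>c\<close> into a
  prefix from the antipode and a suffix from the identity. For \<open>v\<close> in \<open>V0\<close>
  only \<open>c = [v]\<close> survives, which is what \<open>II\<close> encodes.\<close>

lemma lookup_tau:
  "Poly_Mapping.lookup (tau V0 v u) c = (\<Sum>p<length c. if c ! p = v then
     Poly_Mapping.lookup (II V0 (shuffle (antipode (mono_word (take p c))) (mono_word (drop (Suc p) c))) v) u
     else 0)"
proof (cases "v \<in> V0")
  case True
  have zero: "Poly_Mapping.lookup (shuffle (antipode (mono_word d)) (mono_word e)) [] =
      (if d = [] \<and> e = [] then 1 else 0)" for d e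
    by (auto simp: lookup_shuffle antipode_mono anti_def lookup_single when_def)
  \<comment> \<open>With two or more letters, the prefix or the suffix around any position is
    nonempty, so the shuffle has no constant term.\<close>
  consider "c = []" | x where "c = [x]" | x y z where "c = x # y # z"
    by (metis list.exhaust)
  then show ?thesis
  proof cases
    case 3
    have "(if c ! p = v then Poly_Mapping.lookup (II V0 (shuffle (antipode (mono_word (take p c)))
       (mono_word (drop (Suc p) c))) v) u else 0) = 0" if "p < length c" for p
      using that 3 True by (cases p) (simp_all add: lookup_II_in zero)
    then show ?thesis using 3 True by (simp add: tau_def eps_def lookup_single)
  qed (use True in \<open>auto simp: tau_def eps_def lookup_single lookup_II_in zero when_def\<close>)
next
  case False
  have "Poly_Mapping.lookup (tau V0 v u) c = (\<Sum>m\<le>length c.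
      conv (\<lambda>u. Poly_Mapping.lookup (anti u * mono_word [v]) (take m c))
        (\<lambda>u. Poly_Mapping.lookup (mono_word u) (drop m c)) u)"
    using False by (simp add: tau_def lookup_conv)
  also have "\<dots> = (\<Sum>p<length c.
      conv (\<lambda>u. Poly_Mapping.lookup (anti u * mono_word [v]) (take (Suc p) c))
        (\<lambda>u. Poly_Mapping.lookup (mono_word u) (drop (Suc p) c)) u)"
    \<comment> \<open>The cut at \<open>0\<close> drops out because a product ending in
      \<open>v\<close> has no constant term; the other cuts fall just after position
      \<open>p\<close>.\<close>
    by (simp add: sum.atMost_shift lookup_mult_letter)
  also have "\<dots> = (\<Sum>p<length c. if c ! p = v then
     Poly_Mapping.lookup (shuffle (antipode (mono_word (take p c))) (mono_word (drop (Suc p) c))) u else 0)"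
  proof (rule sum.cong)
    fix p assume p: "p \<in> {..<length c}"
    have mono_commute: "Poly_Mapping.lookup (mono_word u) d = Poly_Mapping.lookup (mono_word d) u" for u d :: word
      by (auto simp: lookup_single when_def)
    from p show "conv (\<lambda>u. Poly_Mapping.lookup (anti u * mono_word [v]) (take (Suc p) c))
        (\<lambda>u. Poly_Mapping.lookup (mono_word u) (drop (Suc p) c)) u = (if c ! p = v then
     Poly_Mapping.lookup (shuffle (antipode (mono_word (take p c))) (mono_word (drop (Suc p) c))) u else 0)"
      by (simp add: take_Suc_conv_app_nth lookup_mult_letter lookup_shuffle antipode_mono
          lookup_anti_commute[of _ "take p c"]
          mono_commute[of _ "drop (Suc p) c"])
  qed simp
  finally show ?thesis unfolding II_notin[OF False] .
qed

lemma lookup_tau_letters: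
  assumes "m \<le> n"
  shows "Poly_Mapping.lookup (tau V0 v u) (map a [Suc m..<Suc n]) = (\<Sum>j\<in>{m<..n}. if a j = v then
     Poly_Mapping.lookup (II V0 (shuffle (antipode (letters a (m + 1) (j - 1))) (letters a (j + 1) n)) (a j)) u
     else 0)"
proof -
  \<comment> \<open>Position \<open>p\<close> of the list, counted from \<open>0\<close>, holds the
    letter with index \<open>m + 1 + p\<close>.\<close>
  have "bij_betw (\<lambda>p. Suc m + p) {..<n - m} {m<..n}"
    by (rule bij_betw_byWitness[where f' = "\<lambda>j. j - Suc m"]) (use assms in auto)
  note reindex = sum.reindex_bij_betw[OF this, symmetric]
  show ?thesis
    unfolding lookup_tau reindex
  proof (rule sum.cong)
    fix p assume "p \<in> {..<n - m}"
    then have "p < n - m" by simp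
    then have "map a [Suc m..<Suc n] ! p = a (Suc m + p)"
      "take p (map a [Suc m..<Suc n]) = map a [Suc m..<Suc m + p]"
      "drop (Suc p) (map a [Suc m..<Suc n]) = map a [Suc (Suc m + p)..<Suc n]"
      by (simp_all add: take_map drop_map del: upt_Suc)
    then show "(if map a [Suc m..<Suc n] ! p = v then
        Poly_Mapping.lookup (II V0 (shuffle (antipode (mono_word (take p (map a [Suc m..<Suc n]))))
          (mono_word (drop (Suc p) (map a [Suc m..<Suc n])))) v) u else 0) =
      (if a (Suc m + p) = v then Poly_Mapping.lookup (II V0
        (shuffle (antipode (letters a (m + 1) (Suc m + p - 1)))
          (letters a (Suc m + p + 1) n)) (a (Suc m + p))) u else 0)"
      by (auto simp: letters_def simp del: upt_Suc)
  qed (simp del: upt_Suc)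
qed

section \<open>Recursion on interlaced index sequences\<close>

lemma interlaced_0: "interlaced n 0 = {([n], [])}"
  by (auto simp: interlaced_def length_Suc_conv)

text \<open>Dropping the final entries of both lists leaves a sequence whose closing entry is
  \<open>m\<close>, the former \<open>i ! k\<close>; the removed \<open>j\<close> entry lies in
  \<open>{m<..n}\<close>.\<close>

lemma interlaced_Suc:
  "bij_betw (\<lambda>(m, (i, j), x). (i @ [n], j @ [x]))
     (SIGMA m:{..n}. interlaced m k \<times> {m<..n}) (interlaced n (Suc k))"
proof (rule bij_betw_byWitness[where f' = "\<lambda>(i, j). (i ! k, (butlast i, butlast j), last j)"])
  show "\<forall>s\<in>SIGMA m:{..n}. interlaced m k \<times> {m<..n}.
      (\<lambda>(i, j). (i ! k, (butlast i, butlast j), last j))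
        ((\<lambda>(m, (i, j), x). (i @ [n], j @ [x])) s) = s"
    by (auto simp: interlaced_def nth_append)
  show "\<forall>s\<in>interlaced n (Suc k). (\<lambda>(m, (i, j), x). (i @ [n], j @ [x]))
      ((\<lambda>(i, j). (i ! k, (butlast i, butlast j), last j)) s) = s"
  proof (rule ballI)
    fix s assume "s \<in> interlaced n (Suc k)"
    then obtain i j where s: "s = (i, j)" "(i, j) \<in> interlaced n (Suc k)"
      by (cases s) simp
    then have l: "length i = k + 2" "length j = k + 1" "i ! (k + 1) = n"
      by (auto simp: interlaced_def)
    then have "i \<noteq> []" "j \<noteq> []" by auto
    moreover from this have "last i = n" using l by (simp add: last_conv_nth)
    ultimately show "(\<lambda>(m, (i, j), x). (i @ [n], j @ [x]))
        ((\<lambda>(i, j). (i ! k, (butlast i, butlast j), last j)) s) = s"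
      unfolding s(1) prod.case by (metis append_butlast_last_id)
  qed
  show "(\<lambda>(m, (i, j), x). (i @ [n], j @ [x])) ` (SIGMA m:{..n}. interlaced m k \<times> {m<..n})
      \<subseteq> interlaced n (Suc k)"
    by (auto simp: interlaced_def nth_append less_Suc_eq)
  show "(\<lambda>(i, j). (i ! k, (butlast i, butlast j), last j)) ` interlaced n (Suc k)
      \<subseteq> (SIGMA m:{..n}. interlaced m k \<times> {m<..n})"
  proof (rule subsetI)
    fix t assume "t \<in> (\<lambda>(i, j). (i ! k, (butlast i, butlast j), last j)) ` interlaced n (Suc k)"
    then obtain i j where t: "t = (i ! k, (butlast i, butlast j), last j)"
      and ij: "(i, j) \<in> interlaced n (Suc k)"
      by auto
    then have l: "length i = k + 2" "length j = k + 1" "i ! (k + 1) = n"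
      and le: "\<And>l. l < Suc k \<Longrightarrow> i ! l < j ! l \<and> j ! l \<le> i ! (l + 1)"
      by (auto simp: interlaced_def)
    have "last j = j ! k" using l by (subst last_conv_nth) auto
    moreover have "i ! k \<le> n" using l(3) le[of k] by simp
    ultimately show "t \<in> (SIGMA m:{..n}. interlaced m k \<times> {m<..n})"
      unfolding t using l le[of k] le by (auto simp: interlaced_def nth_butlast)
  qed
qed

lemma finite_interlaced: "finite (interlaced n k)"
proof (induction k arbitrary: n)
  case 0
  then show ?case by (simp add: interlaced_0)
next
  case (Suc k)
  have "finite (SIGMA m:{..n}. interlaced m k \<times> {m<..n})"
    by (intro finite_SigmaI finite_cartesian_product Suc) simp_all
  then show ?case
    using bij_betw_finite[OF interlaced_Suc] by blast
qed

lemma interlaced_le: "(i, j) \<in> interlaced n k \<Longrightarrow> k \<le> n"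
proof (induction k arbitrary: n i j)
  case (Suc k)
  from Suc.prems obtain m i' j' x where "(i', j') \<in> interlaced m k" "m < x" "x \<le> n"
    unfolding bij_betw_imp_surj_on[OF interlaced_Suc, symmetric] by auto
  with Suc.IH[of i' j' m] show ?case by simp
qed simp

text \<open>The left tensor factor of one summand of the formula.\<close>

definition Delta_I_term :: "letter set \<Rightarrow> (nat \<Rightarrow> letter) \<Rightarrow> nat list \<Rightarrow> nat list \<Rightarrow> nat \<Rightarrow> ncpoly" where
  "Delta_I_term V0 a i j k = foldl shuffle (letters a 1 (i ! 0))
            (map (\<lambda>l. II V0
                    (shuffle (antipode (letters a (i ! l + 1) (j ! l - 1)))
                             (letters a (j ! l + 1) (i ! (l + 1))))
                    (a (j ! l)))
               [0..<k])"

lemma Delta_I_term_snoc: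
  assumes "(i, j) \<in> interlaced m k"
  shows "Delta_I_term V0 a (i @ [n]) (j @ [x]) (Suc k) = shuffle (Delta_I_term V0 a i j k)
    (II V0 (shuffle (antipode (letters a (m + 1) (x - 1))) (letters a (x + 1) n)) (a x))"
proof -
  have l: "length i = Suc k" "length j = k" "i ! k = m"
    using assms by (auto simp: interlaced_def)
  have map: "map (\<lambda>l. II V0
        (shuffle (antipode (letters a ((i @ [n]) ! l + 1) ((j @ [x]) ! l - 1)))
           (letters a ((j @ [x]) ! l + 1) ((i @ [n]) ! (l + 1)))) (a ((j @ [x]) ! l))) [0..<k] =
      map (\<lambda>l. II V0
        (shuffle (antipode (letters a (i ! l + 1) (j ! l - 1)))
           (letters a (j ! l + 1) (i ! (l + 1)))) (a (j ! l))) [0..<k]"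
    by (rule map_cong) (auto simp: nth_append l)
  have upt: "[0..<Suc k] = [0..<k] @ [k]" by simp
  show ?thesis
    unfolding Delta_I_term_def upt map_append foldl_append map
    by (simp add: nth_append l)
qed

text \<open>Induction from the right end of \<open>w\<close>, matching the left-nested shuffle
  product: the last letter contributes a factor \<open>tau\<close>, and its cut \<open>m\<close>
  separates the earlier pieces from the last one.\<close>

lemma lookup_gl_word:
  "Poly_Mapping.lookup (conv mono_word (tau_word V0 w) u) (map a [1..<Suc n]) =
    (\<Sum>(i, j)\<in>interlaced n (length w).
       if map a j = w then Poly_Mapping.lookup (Delta_I_term V0 a i j (length w)) u else 0)"
proof (induction w arbitrary: u n rule: rev_induct)
  case Nil
  have "Poly_Mapping.lookup (mono_word u) c = Poly_Mapping.lookup (mono_word c) u" for c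
    by (auto simp: lookup_single when_def)
  then show ?case
    by (simp add: interlaced_0 Delta_I_term_def letters_def del: upt_Suc)
next
  case (snoc v w)
  let ?k = "length w"
  let ?c = "map a [1..<Suc n]"
  let ?I = "\<lambda>m x. II V0 (shuffle (antipode (letters a (m + 1) (x - 1))) (letters a (x + 1) n)) (a x)"
  have tau_word: "tau_word V0 (w @ [v]) = conv (tau_word V0 w) (tau V0 v)"
  proof -
    have "conv (tau V0 v) (eps 1) = tau V0 v" by (intro ext) simp
    then show ?thesis by (simp add: tau_word_append)
  qed
  have "Poly_Mapping.lookup (conv mono_word (tau_word V0 (w @ [v])) u) ?c =
     (\<Sum>m\<le>n. conv (\<lambda>u. Poly_Mapping.lookup (conv mono_word (tau_word V0 w) u) (take m ?c))
        (\<lambda>u. Poly_Mapping.lookup (tau V0 v u) (drop m ?c)) u)"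
    unfolding tau_word conv_assoc[symmetric] by (subst lookup_conv) simp
  also have "\<dots> = (\<Sum>m\<le>n. conv
        (\<lambda>u. \<Sum>(i, j)\<in>interlaced m ?k. if map a j = w then Poly_Mapping.lookup (Delta_I_term V0 a i j ?k) u else 0)
        (\<lambda>u. \<Sum>x\<in>{m<..n}. if a x = v then Poly_Mapping.lookup (?I m x) u else 0) u)"
  proof (rule sum.cong)
    fix m assume "m \<in> {..n}"
    then have "m \<le> n" by simp
    then have "take m ?c = map a [1..<Suc m]" "drop m ?c = map a [Suc m..<Suc n]"
      by (auto simp: take_map drop_map simp del: upt_Suc)
    then show "conv (\<lambda>u. Poly_Mapping.lookup (conv mono_word (tau_word V0 w) u) (take m ?c))
        (\<lambda>u. Poly_Mapping.lookup (tau V0 v u) (drop m ?c)) u = conv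
        (\<lambda>u. \<Sum>(i, j)\<in>interlaced m ?k. if map a j = w then Poly_Mapping.lookup (Delta_I_term V0 a i j ?k) u else 0)
        (\<lambda>u. \<Sum>x\<in>{m<..n}. if a x = v then Poly_Mapping.lookup (?I m x) u else 0) u"
      by (simp only: snoc lookup_tau_letters[OF \<open>m \<le> n\<close>])
  qed simp
  \<comment> \<open>By bilinearity the sums leave the convolution, and the two letter conditions
    merge into one on the extended list.\<close>
  also have "\<dots> = (\<Sum>m\<le>n. \<Sum>(i, j)\<in>interlaced m ?k. \<Sum>x\<in>{m<..n}. if map a (j @ [x]) = w @ [v] then
      conv (Poly_Mapping.lookup (Delta_I_term V0 a i j ?k)) (Poly_Mapping.lookup (?I m x)) u else 0)"
    unfolding case_prod_unfold conv_sum_left conv_sum_right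
    by (intro sum.cong refl) auto
  also have "\<dots> = (\<Sum>m\<le>n. \<Sum>(ij, x)\<in>interlaced m ?k \<times> {m<..n}. if map a (snd ij @ [x]) = w @ [v] then
      Poly_Mapping.lookup (Delta_I_term V0 a (fst ij @ [n]) (snd ij @ [x]) (Suc ?k)) u else 0)"
    unfolding sum.cartesian_product[symmetric]
  proof (intro sum.cong refl, clarify)
    fix m i j
    assume "(i, j) \<in> interlaced m ?k"
    then show "(\<Sum>x\<in>{m<..n}. if map a (j @ [x]) = w @ [v] then
        conv (Poly_Mapping.lookup (Delta_I_term V0 a i j ?k)) (Poly_Mapping.lookup (?I m x)) u else 0) =
      (\<Sum>x\<in>{m<..n}. if map a (snd (i, j) @ [x]) = w @ [v] then
        Poly_Mapping.lookup (Delta_I_term V0 a (fst (i, j) @ [n]) (snd (i, j) @ [x]) (Suc ?k)) u else 0)"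
      by (simp only: Delta_I_term_snoc lookup_shuffle fst_conv snd_conv)
  qed
  also have "\<dots> = (\<Sum>(m, (i, j), x)\<in>(SIGMA m:{..n}. interlaced m ?k \<times> {m<..n}).
      if map a (j @ [x]) = w @ [v] then
      Poly_Mapping.lookup (Delta_I_term V0 a (i @ [n]) (j @ [x]) (Suc ?k)) u else 0)"
    by (subst sum.Sigma) (auto simp: finite_interlaced case_prod_unfold)
  also have "\<dots> = (\<Sum>(i, j)\<in>interlaced n (Suc ?k).
      if map a j = w @ [v] then Poly_Mapping.lookup (Delta_I_term V0 a i j (Suc ?k)) u else 0)"
    by (subst sum.reindex_bij_betw[OF interlaced_Suc, symmetric])
      (simp only: case_prod_unfold fst_conv snd_conv)
  finally show ?case
    unfolding length_append_singleton .
qed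

theorem theorem3p15:
  fixes V0 :: "letter set" and a :: "nat \<Rightarrow> letter" and n :: nat
  shows "Delta_I V0 (letters a 1 n) =
    (\<Sum>k = 0..n. \<Sum>(i, j)\<in>interlaced n k.
       tensor
         (foldl shuffle (letters a 1 (i ! 0))
            (map (\<lambda>l. II V0
                    (shuffle (antipode (letters a (i ! l + 1) (j ! l - 1)))
                             (letters a (j ! l + 1) (i ! (l + 1))))
                    (a (j ! l)))
               [0..<k]))
         (mono_word (map a j)))"
proof -
  have tensor: "Poly_Mapping.lookup (tensor A (mono_word c)) (u, w) = (if c = w then Poly_Mapping.lookup A u else 0)" for A c u w
    unfolding tensor_def
    by (induction A rule: poly_mapping_add_induct)
      (auto simp: linext_add lookup_add linext_single lookup_single when_def)
  have "Poly_Mapping.lookup (\<Sum>k = 0..n. \<Sum>(i, j)\<in>interlaced n k. tensor (Delta_I_term V0 a i j k) (mono_word (map a j))) (u, w) =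
    Poly_Mapping.lookup (conv mono_word (tau_word V0 w) u) (map a [1..<Suc n])" (is "?L = _") for u w
  proof -
    let ?S = "\<Sum>(i, j)\<in>interlaced n (length w). if map a j = w then Poly_Mapping.lookup (Delta_I_term V0 a i j (length w)) u else 0"
    have "?L = (\<Sum>k = 0..n. \<Sum>(i, j)\<in>interlaced n k. if map a j = w then Poly_Mapping.lookup (Delta_I_term V0 a i j k) u else 0)"
      by (simp add: lookup_sum case_prod_unfold tensor)
    \<comment> \<open>Since \<open>j\<close> has length \<open>k\<close>, matching \<open>w\<close>
      forces \<open>k = length w\<close>.\<close>
    also have "\<dots> = (\<Sum>k = 0..n. if k = length w then ?S else 0)"
    proof (intro sum.cong refl)
      fix k
      show "(\<Sum>(i, j)\<in>interlaced n k. if map a j = w then Poly_Mapping.lookup (Delta_I_term V0 a i j k) u else 0) =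
        (if k = length w then ?S else 0)"
      proof (cases "k = length w")
        case False
        then show ?thesis
          by (auto intro!: sum.neutral simp: interlaced_def)
      next
        case True
        show ?thesis unfolding True by simp
      qed
    qed
    also have "\<dots> = ?S"
    \<comment> \<open>If \<open>w\<close> is longer than \<open>n\<close>, the index
      \<open>length w\<close> is outside the range of \<open>k\<close>, but then \<open>?S\<close>
      is an empty sum.\<close>
    proof (cases "length w \<le> n")
      case False
      then have "interlaced n (length w) = {}"
        using interlaced_le by fastforce
      then show ?thesis by simp
    qed simp
    finally show ?thesis unfolding lookup_gl_word .
  qed
  then have "Delta_I V0 (mono_word (map a [1..<Suc n])) =
     (\<Sum>k = 0..n. \<Sum>(i, j)\<in>interlaced n k. tensor (Delta_I_term V0 a i j k) (mono_word (map a j)))"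
    by (rule Delta_I_word)
  then show ?thesis
    by (simp only: letters_def[of a 1 n] Delta_I_term_def)
qed

end
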